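(* Let $\mathcal{K},\mathcal{L}$ be finite index sets, $p_k,q_l\ge0$ with $\sum_{k\in\mathcal{K}}p_k=\sum_{l\in\mathcal{L}}q_l=1$, $\mathbf{u}^{(k)}_{\mathbf{x}}\in\mathbb{R}^N$, $\mathbf{u}^{(l)}_{\mathbf{n}}\in\mathbb{R}^M$, and let $\mathbf{C}^{(k)}_{\mathbf{xx}}$ ($N\times N$) and $\mathbf{C}^{(l)}_{\mathbf{nn}}$ ($M\times M$) be real symmetric positive definite matrices. Fix $\mathbf{x}\in\mathbb{R}^N$, $\mathbf{n}\in\mathbb{R}^M$ and a real $M\times N$ matrix $\mathbf{H}$, put $\mathbf{y}=\mathbf{H}\mathbf{x}+\mathbf{n}$, and let $\breve{G}(\mathbf{H}\mathbf{x}+\mathbf{n})=\|\mathbf{u}_{\mathbf{x}|\mathbf{y}}\|_2^2$, where $\mathbf{u}_{\mathbf{x}|\mathbf{y}}$ is the Gaussian-mixture MMSE estimator defined in the context. Then, with $\mathbf{x}$ and $\mathbf{n}$ held fixed, the derivative of $\breve{G}(\mathbf{H}\mathbf{x}+\mathbf{n})$ with respect to $\mathbf{H}$ is $$\begin{aligned}\frac{\partial\breve{G}(\mathbf{H}\mathbf{x}+\mathbf{n})}{\partial\mathbf{H}}=&-\frac{\sum_{k,l,r,s}h^{k,l,r,s}\left(\mathbf{R}^{(k,l)}+\mathbf{R}^{(r,s)}\right)z^{k,l,r,s}}{\sum_{k,l,r,s}h^{k,l,r,s}}\\&+\frac{\sum_{k,l,r,s}h^{k,l,r,s}\left(\mathbf{D}^{(k,l,r,s)}+\mathbf{D}^{(r,s,k,l)}\right)}{\sum_{k,l,r,s}h^{k,l,r,s}}\\&+\frac{2\left(\sum_{k,l,r,s}h^{k,l,r,s}z^{k,l,r,s}\right)\left(\sum_{k,l}p_kq_lf^{(k,l)}(\mathbf{y})\mathbf{R}^{(k,l)}\right)}{\left(\sum_{i,j}p_iq_jf^{(i,j)}(\mathbf{y})\right)\left(\sum_{k,l,r,s}h^{k,l,r,s}\right)},\end{aligned}$$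 where $k,r,i$ range over $\mathcal{K}$, $l,s,j$ range over $\mathcal{L}$, and $f^{(k,l)}$, $h^{k,l,r,s}$, $z^{k,l,r,s}$, $\mathbf{R}^{(k,l)}$, $\mathbf{D}^{(k,l,r,s)}$ are defined in the context.
   Context: For a scalar function $\phi$ of a matrix $\mathbf{H}$, $\frac{\partial\phi}{\partial\mathbf{H}}$ is the matrix of the same size as $\mathbf{H}$ whose $(i,j)$ entry is $\partial\phi/\partial H_{ij}$. The derivative here is the total derivative: it takes into account both the dependence on $\mathbf{H}$ through $\mathbf{y}=\mathbf{H}\mathbf{x}+\mathbf{n}$ and the explicit dependence on $\mathbf{H}$ of all the quantities below. Define, for $k\in\mathcal{K}$, $l\in\mathcal{L}$: $\mathbf{u}^{(k,l)}_{\mathbf{y}}=\mathbf{H}\mathbf{u}^{(k)}_{\mathbf{x}}+\mathbf{u}^{(l)}_{\mathbf{n}}$; $\mathbf{C}^{(k,l)}_{\mathbf{yy}}=\mathbf{H}\mathbf{C}^{(k)}_{\mathbf{xx}}\mathbf{H}^T+\mathbf{C}^{(l)}_{\mathbf{nn}}$; $\mathbf{C}^{-(k,l)}_{\mathbf{yy}}=(\mathbf{C}^{(k,l)}_{\mathbf{yy}})^{-1}$; $\mathbf{w}^{(k,l)}=\mathbf{y}-\mathbf{u}^{(k,l)}_{\mathbf{y}}$; $$f^{(k,l)}(\mathbf{y})=\frac{\exp\left(-\tfrac12(\mathbf{w}^{(k,l)})^T\mathbf{C}^{-(k,l)}_{\mathbf{yy}}\mathbf{w}^{(k,l)}\right)}{(2\pi)^{M/2}|\mathbf{C}^{(k,l)}_{\mathbf{yy}}|^{1/2}};$$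 $$\mathbf{u}^{(k,l)}_{\mathbf{x}|\mathbf{y}}=\mathbf{u}^{(k)}_{\mathbf{x}}+\mathbf{C}^{(k)}_{\mathbf{xx}}\mathbf{H}^T\mathbf{C}^{-(k,l)}_{\mathbf{yy}}\mathbf{w}^{(k,l)};\qquad \mathbf{u}_{\mathbf{x}|\mathbf{y}}=\frac{\sum_{k,l}p_kq_lf^{(k,l)}(\mathbf{y})\,\mathbf{u}^{(k,l)}_{\mathbf{x}|\mathbf{y}}}{\sum_{k,l}p_kq_lf^{(k,l)}(\mathbf{y})}.$$ (When $\mathbf{x},\mathbf{n}$ are independent Gaussian mixtures with these parameters, $\mathbf{u}_{\mathbf{x}|\mathbf{y}}=E\{\mathbf{x}\mid\mathbf{y}\}$.) For $k,r\in\mathcal{K}$ and $l,s\in\mathcal{L}$ define $z^{k,l,r,s}=(\mathbf{u}^{(k,l)}_{\mathbf{x}|\mathbf{y}})^T\mathbf{u}^{(r,s)}_{\mathbf{x}|\mathbf{y}}$, $\quad h^{k,l,r,s}=p_kq_lp_rq_s f^{(k,l)}(\mathbf{y})f^{(r,s)}(\mathbf{y})$, $$\mathbf{R}^{(k,l)}=\mathbf{C}^{-(k,l)}_{\mathbf{yy}}\mathbf{w}^{(k,l)}(\mathbf{x}-\mathbf{u}^{(k)}_{\mathbf{x}})^T+\mathbf{C}^{-(k,l)}_{\mathbf{yy}}\left(\mathbf{I}-\mathbf{w}^{(k,l)}(\mathbf{w}^{(k,l)})^T\mathbf{C}^{-(k,l)}_{\mathbf{yy}}\right)\mathbf{H}\mathbf{C}^{(k)}_{\mathbf{xx}},$$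 $$\mathbf{C}^{(k,l,r,s)}=\mathbf{C}^{-(k,l)}_{\mathbf{yy}}\mathbf{w}^{(k,l)}(\mathbf{u}^{(r,s)}_{\mathbf{x}|\mathbf{y}})^T\mathbf{C}^{(k)}_{\mathbf{xx}}\mathbf{H}^T\mathbf{C}^{-(k,l)}_{\mathbf{yy}},$$ $$\mathbf{D}^{(k,l,r,s)}=\mathbf{C}^{-(k,l)}_{\mathbf{yy}}\mathbf{w}^{(k,l)}(\mathbf{u}^{(r,s)}_{\mathbf{x}|\mathbf{y}})^T\mathbf{C}^{(k)}_{\mathbf{xx}}-\left(\mathbf{C}^{(k,l,r,s)}+(\mathbf{C}^{(k,l,r,s)})^T\right)\mathbf{H}\mathbf{C}^{(k)}_{\mathbf{xx}}+\mathbf{C}^{-(k,l)}_{\mathbf{yy}}\mathbf{H}\mathbf{C}^{(k)}_{\mathbf{xx}}\mathbf{u}^{(r,s)}_{\mathbf{x}|\mathbf{y}}(\mathbf{x}-\mathbf{u}^{(k)}_{\mathbf{x}})^T.$$ *)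

theory Defs
  imports "HOL-Analysis.Analysis"
begin

definition sym_pos_def :: "real^'d^'d \<Rightarrow> bool" where
  "sym_pos_def A \<longleftrightarrow> transpose A = A \<and> (\<forall>v. v \<noteq> 0 \<longrightarrow> 0 < v \<bullet> (A *v v))"

text \<open>The outer product \<open>a b\<^sup>T\<close> of two column vectors.\<close>

definition outer :: "real^'m \<Rightarrow> real^'n \<Rightarrow> real^'n^'m" where
  "outer a b = (\<chi> i j. a $ i * b $ j)"

text \<open>\<open>has_matrix_gradient \<phi> D H\<close>: for all \<open>i, j\<close> the partial derivative of \<open>\<phi>\<close> with respect to
  the entry \<open>H\<^sub>i\<^sub>j\<close> exists at \<open>H\<close>, and it equals \<open>D\<^sub>i\<^sub>j\<close>.\<close>

definition has_matrix_gradient ::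
    "(real^'n^'m \<Rightarrow> real) \<Rightarrow> real^'n^'m \<Rightarrow> real^'n^'m \<Rightarrow> bool" where
  "has_matrix_gradient \<phi> D H \<longleftrightarrow>
    (\<forall>i j. ((\<lambda>t. \<phi> (\<chi> a b. if a = i \<and> b = j then t else H $ a $ b))
              has_real_derivative D $ i $ j) (at (H $ i $ j)))"

text \<open>Parameters of a Gaussian mixture in \<open>\<real>\<^sup>d\<close>. Only the components indexed by \<open>gm_idx\<close> are
  meaningful.\<close>

record ('k, 'd) gauss_mix =
  gm_idx :: "'k set"
  gm_weight :: "'k \<Rightarrow> real"
  gm_mean :: "'k \<Rightarrow> real^'d::finite"
  gm_cov :: "'k \<Rightarrow> real^'d::finite^'d"

text \<open>Throughout, \<open>X\<close> holds the parameters of the input \<open>x\<close>, namely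
  \<open>(\<K>, p\<^sub>k, u\<^sub>x\<^sup>(\<^sup>k\<^sup>), C\<^sub>x\<^sub>x\<^sup>(\<^sup>k\<^sup>))\<close>, and \<open>V\<close> those of the noise \<open>n\<close>, namely
  \<open>(\<L>, q\<^sub>l, u\<^sub>n\<^sup>(\<^sup>l\<^sup>), C\<^sub>n\<^sub>n\<^sup>(\<^sup>l\<^sup>))\<close>.
  The matrix \<open>H\<close> and the observation \<open>y\<close> are separate arguments; the total
  derivative with respect to \<open>H\<close> arises by substituting \<open>y = H x + n\<close> before differentiating.\<close>

definition u_y :: "('k,'n) gauss_mix \<Rightarrow> ('l,'m) gauss_mix \<Rightarrow> real^'n^'m \<Rightarrow> 'k \<Rightarrow> 'l \<Rightarrow> real^'m" where
  "u_y X V H k l = H *v gm_mean X k + gm_mean V l"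

definition C_yy :: "('k,'n) gauss_mix \<Rightarrow> ('l,'m) gauss_mix \<Rightarrow> real^'n^'m \<Rightarrow> 'k \<Rightarrow> 'l \<Rightarrow> real^'m^'m" where
  "C_yy X V H k l = H ** gm_cov X k ** transpose H + gm_cov V l"

definition Cinv_yy :: "('k,'n) gauss_mix \<Rightarrow> ('l,'m) gauss_mix \<Rightarrow> real^'n^'m \<Rightarrow> 'k \<Rightarrow> 'l \<Rightarrow> real^'m^'m" where
  "Cinv_yy X V H k l = matrix_inv (C_yy X V H k l)"

definition w_vec :: "('k,'n) gauss_mix \<Rightarrow> ('l,'m) gauss_mix \<Rightarrow> real^'n^'m \<Rightarrow> real^'m \<Rightarrow>
    'k \<Rightarrow> 'l \<Rightarrow> real^'m" where
  "w_vec X V H y k l = y - u_y X V H k l"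

definition f_dens :: "('k,'n) gauss_mix \<Rightarrow> ('l,'m) gauss_mix \<Rightarrow> real^'n^'m \<Rightarrow> real^'m \<Rightarrow>
    'k \<Rightarrow> 'l \<Rightarrow> real" where
  "f_dens X V H y k l =
    exp (- (1/2) * (w_vec X V H y k l \<bullet> (Cinv_yy X V H k l *v w_vec X V H y k l)))
      / ((2 * pi) powr (real CARD('m) / 2) * sqrt (det (C_yy X V H k l)))"

definition u_comp :: "('k,'n) gauss_mix \<Rightarrow> ('l,'m) gauss_mix \<Rightarrow> real^'n^'m \<Rightarrow> real^'m \<Rightarrow>
    'k \<Rightarrow> 'l \<Rightarrow> real^'n" where
  "u_comp X V H y k l = gm_mean X k
     + (gm_cov X k ** transpose H ** Cinv_yy X V H k l) *v w_vec X V H y k l"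

definition f_mix :: "('k,'n) gauss_mix \<Rightarrow> ('l,'m) gauss_mix \<Rightarrow> real^'n^'m \<Rightarrow> real^'m \<Rightarrow> real" where
  "f_mix X V H y =
    (\<Sum>k\<in>gm_idx X. \<Sum>l\<in>gm_idx V. gm_weight X k * gm_weight V l * f_dens X V H y k l)"

definition u_mmse :: "('k,'n) gauss_mix \<Rightarrow> ('l,'m) gauss_mix \<Rightarrow> real^'n^'m \<Rightarrow> real^'m \<Rightarrow> real^'n" where
  "u_mmse X V H y =
    (\<Sum>k\<in>gm_idx X. \<Sum>l\<in>gm_idx V.
       (gm_weight X k * gm_weight V l * f_dens X V H y k l) *\<^sub>R u_comp X V H y k l)
      /\<^sub>R f_mix X V H y"

definition G_breve :: "('k,'n) gauss_mix \<Rightarrow> ('l,'m) gauss_mix \<Rightarrow> real^'n^'m \<Rightarrow> real^'m \<Rightarrow> real" where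
  "G_breve X V H y = (norm (u_mmse X V H y))\<^sup>2"

definition z_coef :: "('k,'n) gauss_mix \<Rightarrow> ('l,'m) gauss_mix \<Rightarrow> real^'n^'m \<Rightarrow> real^'m \<Rightarrow>
    'k \<Rightarrow> 'l \<Rightarrow> 'k \<Rightarrow> 'l \<Rightarrow> real" where
  "z_coef X V H y k l r s = u_comp X V H y k l \<bullet> u_comp X V H y r s"

definition h_coef :: "('k,'n) gauss_mix \<Rightarrow> ('l,'m) gauss_mix \<Rightarrow> real^'n^'m \<Rightarrow> real^'m \<Rightarrow>
    'k \<Rightarrow> 'l \<Rightarrow> 'k \<Rightarrow> 'l \<Rightarrow> real" where
  "h_coef X V H y k l r s =
    gm_weight X k * gm_weight V l * gm_weight X r * gm_weight V s
      * f_dens X V H y k l * f_dens X V H y r s"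

definition R_mat :: "('k,'n) gauss_mix \<Rightarrow> ('l,'m) gauss_mix \<Rightarrow> real^'n^'m \<Rightarrow> real^'n \<Rightarrow> real^'m \<Rightarrow>
    'k \<Rightarrow> 'l \<Rightarrow> real^'n^'m" where
  "R_mat X V H x y k l =
    outer (Cinv_yy X V H k l *v w_vec X V H y k l) (x - gm_mean X k)
    + Cinv_yy X V H k l
        ** (mat 1 - outer (w_vec X V H y k l) (w_vec X V H y k l) ** Cinv_yy X V H k l)
        ** H ** gm_cov X k"

definition C_mat :: "('k,'n) gauss_mix \<Rightarrow> ('l,'m) gauss_mix \<Rightarrow> real^'n^'m \<Rightarrow> real^'m \<Rightarrow>
    'k \<Rightarrow> 'l \<Rightarrow> 'k \<Rightarrow> 'l \<Rightarrow> real^'m^'m" where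
  "C_mat X V H y k l r s =
    outer (Cinv_yy X V H k l *v w_vec X V H y k l) (u_comp X V H y r s)
      ** gm_cov X k ** transpose H ** Cinv_yy X V H k l"

definition D_mat :: "('k,'n) gauss_mix \<Rightarrow> ('l,'m) gauss_mix \<Rightarrow> real^'n^'m \<Rightarrow> real^'n \<Rightarrow> real^'m \<Rightarrow>
    'k \<Rightarrow> 'l \<Rightarrow> 'k \<Rightarrow> 'l \<Rightarrow> real^'n^'m" where
  "D_mat X V H x y k l r s =
    outer (Cinv_yy X V H k l *v w_vec X V H y k l) (u_comp X V H y r s) ** gm_cov X k
    - (C_mat X V H y k l r s + transpose (C_mat X V H y k l r s)) ** H ** gm_cov X k
    + outer ((Cinv_yy X V H k l ** H ** gm_cov X k) *v u_comp X V H y r s) (x - gm_mean X k)"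

end

theory Submission
  imports Defs
begin

text \<open>Along a differentiable path of matrices with velocity \<open>E\<close> through \<open>H\<close>, Jacobi's formula and
  the derivative of the inverse show that each component density \<open>f\<close> has derivative
  \<open>- f (E \<bullet> R)\<close>, and that pairing the derivative of a component mean \<open>u\<^sub>x\<^sub>|\<^sub>y\<close> with another
  component mean (held fixed) gives \<open>E \<bullet> D\<close>. As the squared norm of the estimator is the
  quotient of \<open>\<Sum> h z\<close> by \<open>(\<Sum> p q f)\<^sup>2 = \<Sum> h\<close>, the quotient rule yields the gradient, whose entries
  are read off by taking for \<open>E\<close> the matrix units.\<close>

section \<open>Differentiating determinants and inverses\<close>

text \<open>Coordinate projections are bounded linear; conversely a vector is the finite sum of its
  coordinates embedded along the axes, and these embeddings are bounded linear too.\<close>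

lemma has_vector_derivative_vec_iff:
  fixes f :: "real \<Rightarrow> ('a::euclidean_space)^'n"
  shows "(f has_vector_derivative f') F \<longleftrightarrow>
    (\<forall>i. ((\<lambda>t. f t $ i) has_vector_derivative f' $ i) F)"
proof
  assume "(f has_vector_derivative f') F"
  then show "\<forall>i. ((\<lambda>t. f t $ i) has_vector_derivative f' $ i) F"
    by (intro allI bounded_linear.has_vector_derivative[OF bounded_linear_vec_nth])
next
  assume f: "\<forall>i. ((\<lambda>t. f t $ i) has_vector_derivative f' $ i) F"
  have lin: "bounded_linear (\<lambda>x. axis i x :: 'a^'n)" for i
    by (intro linear_conv_bounded_linear[THEN iffD1] linearI) (auto simp: axis_def vec_eq_iff)
  have rep: "x = (\<Sum>i\<in>UNIV. axis i (x $ i))" for x :: "'a^'n"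
    by (simp add: vec_eq_iff axis_def sum.delta if_distrib cong: if_cong)
  have "((\<lambda>t. \<Sum>i\<in>UNIV. axis i (f t $ i)) has_vector_derivative (\<Sum>i\<in>UNIV. axis i (f' $ i))) F"
    by (intro has_vector_derivative_sum bounded_linear.has_vector_derivative[OF lin]) (use f in auto)
  then show "(f has_vector_derivative f') F"
    by (simp flip: rep)
qed

lemma has_vector_derivative_matrix_iff:
  fixes A :: "real \<Rightarrow> real^'n^'m"
  shows "(A has_vector_derivative A') F \<longleftrightarrow>
    (\<forall>i j. ((\<lambda>t. A t $ i $ j) has_real_derivative A' $ i $ j) F)"
  by (simp add: has_vector_derivative_vec_iff has_real_derivative_iff_has_vector_derivative)

section \<open>Product rules for matrix operations\<close>

lemma bounded_bilinear_matrix_mult: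
  "bounded_bilinear (\<lambda>(A::real^'n^'m) (B::real^'p^'n). A ** B)"
  unfolding bilinear_conv_bounded_bilinear[symmetric] bilinear_def
  by (auto intro!: linearI simp: matrix_matrix_mult_def vec_eq_iff algebra_simps sum.distrib sum_distrib_left)

lemma bounded_bilinear_matrix_vector_mult:
  "bounded_bilinear (\<lambda>(A::real^'n^'m) v. A *v v)"
  unfolding bilinear_conv_bounded_bilinear[symmetric] bilinear_def
  by (auto intro!: linearI simp: matrix_vector_mult_def vec_eq_iff algebra_simps sum.distrib sum_distrib_left)

lemma bounded_linear_transpose: "bounded_linear (transpose :: real^'n^'m \<Rightarrow> real^'m^'n)"
  unfolding linear_conv_bounded_linear[symmetric]
  by (auto intro!: linearI simp: transpose_def vec_eq_iff)

lemmas has_vector_derivative_matrix_mult =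
  bounded_bilinear.has_vector_derivative[OF bounded_bilinear_matrix_mult]
lemmas has_vector_derivative_matrix_vector_mult =
  bounded_bilinear.has_vector_derivative[OF bounded_bilinear_matrix_vector_mult]
lemmas has_vector_derivative_transpose =
  bounded_linear.has_vector_derivative[OF bounded_linear_transpose]

lemma has_real_derivative_inner:
  assumes "(f has_vector_derivative f') (at t)" "(g has_vector_derivative g') (at t)"
  shows "((\<lambda>t. f t \<bullet> g t) has_real_derivative (f t \<bullet> g' + f' \<bullet> g t)) (at t)"
  unfolding has_real_derivative_iff_has_vector_derivative
  by (rule bounded_bilinear.has_vector_derivative[OF bounded_bilinear_inner assms])

text \<open>The product rule applied to each term of the Leibniz expansion.\<close>

lemma has_real_derivative_det:
  fixes A :: "real \<Rightarrow> real^'n^'n"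
  assumes "(A has_vector_derivative A') (at t)"
  shows "((\<lambda>t. det (A t)) has_real_derivative
    (\<Sum>p | p permutes UNIV. of_int (sign p) *
      (\<Sum>i\<in>UNIV. A' $ i $ p i * (\<Prod>j\<in>UNIV - {i}. A t $ j $ p j)))) (at t)"
  unfolding det_def
  using assms unfolding has_vector_derivative_matrix_iff
  by (intro DERIV_sum DERIV_cmult has_field_derivative_prod) auto

lemma permutes_fixing_all_but_one:
  assumes "p permutes UNIV" and fixed: "\<And>j. j \<noteq> i \<Longrightarrow> p j = j"
  shows "p = id"
proof -
  have "p i = i"
    using assms by (metis permutes_inj injD)
  then show ?thesis
    using fixed by (metis eq_id_iff)
qed

text \<open>A permutation other than the identity moves at least two points. Deleting row
  \<open>i\<close> thus leaves an off-diagonal zero of the identity matrix in the product, and only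
  the identity permutation contributes.\<close>

lemma has_real_derivative_det_mat_1:
  fixes A :: "real \<Rightarrow> real^'n^'n"
  assumes A: "(A has_vector_derivative A') (at t)" and "A t = mat 1"
  shows "((\<lambda>t. det (A t)) has_real_derivative trace A') (at t)"
proof -
  have zero: "(\<Prod>j\<in>UNIV - {i}. A t $ j $ p j) = 0" if p: "p permutes UNIV" "p \<noteq> id" for p i
  proof -
    obtain j where "j \<noteq> i" "p j \<noteq> j"
      using permutes_fixing_all_but_one[OF p(1)] p(2) by blast
    then show ?thesis
      using \<open>A t = mat 1\<close> by (intro prod_zero) (auto simp: mat_def intro!: bexI[of _ j])
  qed
  have "(\<Sum>p | p permutes UNIV. of_int (sign p) *
      (\<Sum>i\<in>UNIV. A' $ i $ p i * (\<Prod>j\<in>UNIV - {i}. A t $ j $ p j)))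
    = (\<Sum>p\<in>{id}. of_int (sign p) *
      (\<Sum>i\<in>UNIV. A' $ i $ p i * (\<Prod>j\<in>UNIV - {i}. A t $ j $ p j)))"
    by (rule sum.mono_neutral_right) (auto simp: zero finite_permutations permutes_id)
  also have "\<dots> = trace A'"
    using \<open>A t = mat 1\<close> by (simp add: trace_def mat_def sign_id)
  finally show ?thesis
    using has_real_derivative_det[OF A] by simp
qed

lemma matrix_inv_mult:
  fixes A :: "real^'n^'n"
  assumes "det A \<noteq> 0"
  shows "A ** matrix_inv A = mat 1" and "matrix_inv A ** A = mat 1"
proof -
  have "\<exists>B. A ** B = mat 1 \<and> B ** A = mat 1"
    using assms invertible_det_nz[of A] unfolding invertible_def by simp
  from someI_ex[OF this] show "A ** matrix_inv A = mat 1" "matrix_inv A ** A = mat 1"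
    unfolding matrix_inv_def by auto
qed

text \<open>Multiplying the path by the constant matrix \<open>matrix_inv (A t)\<close> makes it
  pass through the identity at \<open>t\<close>; multiplicativity of the determinant undoes this
  normalisation.\<close>

lemma jacobi_formula:
  fixes A :: "real \<Rightarrow> real^'n^'n"
  assumes A: "(A has_vector_derivative A') (at t)" and "det (A t) \<noteq> 0"
  shows "((\<lambda>t. det (A t)) has_real_derivative det (A t) * trace (matrix_inv (A t) ** A')) (at t)"
proof -
  note inv = matrix_inv_mult[OF \<open>det (A t) \<noteq> 0\<close>]
  have "((\<lambda>s. matrix_inv (A t) ** A s) has_vector_derivative matrix_inv (A t) ** A') (at t)"
    by (rule bounded_linear.has_vector_derivative[OF
        bounded_bilinear.bounded_linear_right[OF bounded_bilinear_matrix_mult] A])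
  from has_real_derivative_det_mat_1[OF this inv(2)]
  have "((\<lambda>s. det (A t) * det (matrix_inv (A t) ** A s)) has_real_derivative
      det (A t) * trace (matrix_inv (A t) ** A')) (at t)"
    by (rule DERIV_cmult)
  moreover have "det (A t) * det (matrix_inv (A t) ** A s) = det (A s)" for s
  proof -
    have "det (A t) * det (matrix_inv (A t)) = 1"
      by (metis det_I det_mul inv(1))
    then show ?thesis
      by (simp add: det_mul flip: mult.assoc)
  qed
  ultimately show ?thesis
    by simp
qed

text \<open>Column \<open>l\<close> of the inverse solves the linear system with right-hand side
  \<open>axis l 1\<close>. Entries of the inverse thereby become quotients of determinants, which
  are known to be differentiable.\<close>

lemma matrix_inv_cramer:
  fixes A :: "real^'n^'n"
  assumes "det A \<noteq> 0"
  shows "matrix_inv A $ k $ l = det (\<chi> i j. if j = k then axis l 1 $ i else A $ i $ j) / det A"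
proof -
  have "A *v (matrix_inv A *v axis l 1) = axis l 1"
    by (simp add: matrix_vector_mul_assoc matrix_inv_mult[OF assms])
  then have "matrix_inv A *v axis l 1
      = (\<chi> k. det (\<chi> i j. if j = k then axis l 1 $ i else A $ i $ j) / det A)"
    using cramer[OF assms] by blast
  then have "(matrix_inv A *v axis l 1) $ k
      = det (\<chi> i j. if j = k then axis l 1 $ i else A $ i $ j) / det A"
    by simp
  then show ?thesis
    by (simp add: matrix_vector_mul_component inner_axis)
qed

text \<open>By Cramer's rule the inverse is differentiable; its derivative is then forced by
  differentiating \<open>A\<^sup>-\<^sup>1 A = I\<close>.\<close>

lemma has_vector_derivative_matrix_inv:
  fixes A :: "real \<Rightarrow> real^'n^'n"
  assumes A: "(A has_vector_derivative A') (at t)" and nz: "det (A t) \<noteq> 0"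
  shows "((\<lambda>s. matrix_inv (A s)) has_vector_derivative
    - (matrix_inv (A t) ** A' ** matrix_inv (A t))) (at t)"
proof -
  have "((\<lambda>s. det (A s)) \<longlongrightarrow> det (A t)) (at t)"
    using DERIV_isCont[OF has_real_derivative_det[OF A]] by (simp add: isCont_def)
  \<comment> \<open>Determinants are continuous along the path, so \<open>A s\<close> stays
    invertible for \<open>s\<close> near \<open>t\<close>.\<close>
  then have ev: "\<forall>\<^sub>F s in nhds t. det (A s) \<noteq> 0"
    using nz by (simp add: eventually_nhds_conv_at tendsto_imp_eventually_ne)
  have "\<exists>d. ((\<lambda>s. matrix_inv (A s) $ k $ l) has_real_derivative d) (at t)" for k l
  proof -
    have "((\<lambda>s. \<chi> i j. if j = k then axis l 1 $ i else A s $ i $ j) has_vector_derivative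
        (\<chi> i j. if j = k then 0 else A' $ i $ j)) (at t)"
      using A unfolding has_vector_derivative_matrix_iff by auto
    note quot = DERIV_divide[OF has_real_derivative_det[OF this] has_real_derivative_det[OF A] nz]
    have "\<forall>\<^sub>F s in nhds t. matrix_inv (A s) $ k $ l =
        det (\<chi> i j. if j = k then axis l 1 $ i else A s $ i $ j) / det (A s)"
      using ev by eventually_elim (rule matrix_inv_cramer)
    from DERIV_cong_ev[OF refl this refl, THEN iffD2, OF quot] show ?thesis
      by (rule exI)
  qed
  then obtain B where "\<And>k l. ((\<lambda>s. matrix_inv (A s) $ k $ l) has_real_derivative B k l) (at t)"
    by metis
  then have B: "((\<lambda>s. matrix_inv (A s)) has_vector_derivative (\<chi> k l. B k l)) (at t)"
    by (simp add: has_vector_derivative_matrix_iff)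
  let ?B = "\<chi> k l. B k l" and ?P = "matrix_inv (A t)"
  have deriv: "((\<lambda>s. matrix_inv (A s) ** A s) has_vector_derivative ?P ** A' + ?B ** A t) (at t)"
    by (rule has_vector_derivative_matrix_mult[OF B A])
  \<comment> \<open>Near \<open>t\<close> the product is constantly the identity, so the derivative
    just computed must be zero.\<close>
  have "\<forall>\<^sub>F s in nhds t. s \<in> UNIV \<longrightarrow> matrix_inv (A s) ** A s = mat 1"
    using ev by eventually_elim (simp add: matrix_inv_mult)
  from has_vector_derivative_cong_ev[OF this matrix_inv_mult(2)[OF nz], THEN iffD1, OF deriv]
  have "((\<lambda>s. mat 1 :: real^'n^'n) has_vector_derivative ?P ** A' + ?B ** A t) (at t)" .
  then have "?P ** A' + ?B ** A t = 0"
    using has_vector_derivative_const vector_derivative_unique_at by blast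
  \<comment> \<open>Multiplying by the inverse on the right isolates \<open>?B\<close>.\<close>
  then have "(?P ** A' + ?B ** A t) ** ?P = 0"
    by (simp add: matrix_matrix_mult_def vec_eq_iff)
  then have "?B + ?P ** A' ** ?P = 0"
    by (simp add: add.commute bounded_bilinear.add_left[OF bounded_bilinear_matrix_mult]
        matrix_inv_mult nz flip: matrix_mul_assoc)
  then have "?B = - (?P ** A' ** ?P)"
    by (rule eq_neg_iff_add_eq_0[THEN iffD2])
  then show ?thesis
    using B by simp
qed

section \<open>Positive definite matrices\<close>

text \<open>A singular matrix has a nonzero kernel vector, on which the quadratic form
  vanishes.\<close>

lemma sym_pos_def_det_nonzero:
  fixes A :: "real^'n^'n"
  assumes "sym_pos_def A"
  shows "det A \<noteq> 0"
proof
  assume "det A = 0"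
  then obtain v where "v \<noteq> 0" "A *v v = 0"
    using invertible_det_nz[of A] invertible_left_inverse[of A] matrix_left_invertible_ker[of A] by auto
  then show False
    using assms by (metis inner_zero_right less_irrefl sym_pos_def_def)
qed

text \<open>The segment from the identity to \<open>A\<close> stays inside the positive definite cone, where the
  determinant does not vanish.\<close>

lemma sym_pos_def_det_pos:
  fixes A :: "real^'n^'n"
  assumes "sym_pos_def A"
  shows "0 < det A"
proof (rule ccontr)
  define B where "B t = (1 - t) *\<^sub>R mat 1 + t *\<^sub>R A" for t
  assume "\<not> 0 < det A"
  then have "det (B 1) \<le> 0" "0 \<le> det (B 0)"
    by (auto simp: B_def)
  moreover have "continuous_on {0..1} (\<lambda>t. det (B t))"
    unfolding B_def det_def by (auto intro!: continuous_intros)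
  ultimately obtain t where t: "0 \<le> t" "t \<le> 1" "det (B t) = 0"
    using IVT2'[of "\<lambda>t. det (B t)" 1 0 0] by auto
  have "sym_pos_def (B t)"
    unfolding sym_pos_def_def
  proof (intro conjI allI impI)
    show "transpose (B t) = B t"
      using assms by (simp add: B_def sym_pos_def_def vec_eq_iff transpose_def mat_def)
    fix v :: "real^'n" assume "v \<noteq> 0"
    have "v \<bullet> (B t *v v) = (1 - t) * (v \<bullet> v) + t * (v \<bullet> (A *v v))"
      by (simp add: B_def matrix_vector_mult_add_rdistrib inner_add_right
          flip: scaleR_matrix_vector_assoc)
    moreover have "0 < v \<bullet> v" "0 < v \<bullet> (A *v v)"
      using assms \<open>v \<noteq> 0\<close> by (auto simp: sym_pos_def_def)
    \<comment> \<open>For \<open>t = 0\<close> the form is \<open>v \<bullet> v\<close>; for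
      \<open>t > 0\<close> the term from \<open>A\<close> is positive and the other one
      nonnegative.\<close>
    ultimately show "0 < v \<bullet> (B t *v v)"
      using t by (cases "t = 0") (auto intro: add_nonneg_pos)
  qed
  then show False
    using sym_pos_def_det_nonzero t by blast
qed

text \<open>The first summand has the form of \<open>A\<close> evaluated at
  \<open>transpose H *v v\<close>. This vector may be zero, so strict positivity comes from
  \<open>B\<close>.\<close>

lemma sym_pos_def_congruence_add:
  fixes A :: "real^'n^'n" and B :: "real^'m^'m" and H :: "real^'n^'m"
  assumes A: "sym_pos_def A" and B: "sym_pos_def B"
  shows "sym_pos_def (H ** A ** transpose H + B)"
  unfolding sym_pos_def_def
proof (intro conjI allI impI)
  show "transpose (H ** A ** transpose H + B) = H ** A ** transpose H + B"
    using A B unfolding sym_pos_def_def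
    by (simp add: linear_add[OF bounded_linear.linear[OF bounded_linear_transpose]]
        matrix_transpose_mul matrix_mul_assoc)
  fix v :: "real^'m" assume "v \<noteq> 0"
  let ?a = "transpose H *v v"
  have "v \<bullet> ((H ** A ** transpose H) *v v) = ?a \<bullet> (A *v ?a)"
    by (simp add: dot_lmul_matrix del: transpose_matrix_vector flip: matrix_vector_mul_assoc)
      (simp add: dot_lmul_matrix)
  moreover have "0 \<le> ?a \<bullet> (A *v ?a)"
    using A unfolding sym_pos_def_def by (metis inner_zero_left less_imp_le order_refl)
  moreover have "0 < v \<bullet> (B *v v)"
    using B \<open>v \<noteq> 0\<close> by (simp add: sym_pos_def_def)
  ultimately show "0 < v \<bullet> ((H ** A ** transpose H + B) *v v)"
    by (simp add: matrix_vector_mult_add_rdistrib inner_add_right)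
qed

section \<open>Outer products and the Frobenius inner product\<close>

lemmas matrix_mult_diff_left = bounded_bilinear.diff_left[OF bounded_bilinear_matrix_mult]
lemmas matrix_mult_diff_right = bounded_bilinear.diff_right[OF bounded_bilinear_matrix_mult]
lemmas matrix_mult_add_left = bounded_bilinear.add_left[OF bounded_bilinear_matrix_mult]

text \<open>Turns a bilinear expression that is linear in the velocity \<open>E\<close> into a
  Frobenius pairing, from which the coefficient matrix can be read off.\<close>

lemma inner_outer: "E \<bullet> outer a b = a \<bullet> (E *v b)"
  by (simp add: inner_vec_def outer_def matrix_vector_mult_def sum_distrib_left mult_ac)

lemma outer_matrix_mult: "outer a b ** B = outer a (transpose B *v b)"
  by (simp add: outer_def matrix_matrix_mult_def vector_matrix_mult_def vec_eq_iff
      sum_distrib_left mult_ac)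

lemma matrix_mult_outer: "A ** outer a b = outer (A *v a) b"
  by (simp add: outer_def matrix_matrix_mult_def matrix_vector_mult_def vec_eq_iff
      sum_distrib_left sum_distrib_right mult_ac)

lemma transpose_outer: "transpose (outer a b) = outer b a"
  by (simp add: outer_def transpose_def vec_eq_iff mult.commute)

lemma inner_matrix_vector_mult_sym:
  fixes A :: "real^'n^'n"
  assumes "transpose A = A"
  shows "(A *v a) \<bullet> b = a \<bullet> (A *v b)"
  by (metis assms dot_lmul_matrix transpose_matrix_vector)

lemma inner_matrix_eq_trace: "(A :: real^'n^'m) \<bullet> B = trace (transpose A ** B)"
  unfolding inner_vec_def trace_def matrix_matrix_mult_def transpose_def
  by (subst sum.swap) simp

lemma trace_transpose: "trace (transpose A) = trace A"
  by (simp add: trace_def transpose_def)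

lemma transpose_matrix_inv:
  fixes A :: "real^'n^'n"
  assumes "transpose A = A" "det A \<noteq> 0"
  shows "transpose (matrix_inv A) = matrix_inv A"
proof -
  have "transpose (matrix_inv A) ** A = mat 1"
    by (metis assms matrix_inv_mult(1) matrix_transpose_mul transpose_mat)
  then show ?thesis
    by (metis assms(2) matrix_inv_mult(1) matrix_mul_assoc matrix_mul_lid matrix_mul_rid)
qed

text \<open>The bracket is the variation of \<open>H ** A ** transpose H\<close> in direction
  \<open>E\<close>. Its two terms are transposes of each other, so by symmetry of \<open>P\<close>
  and cyclicity they have equal traces against \<open>P\<close>.\<close>

lemma trace_symmetrized_variation:
  fixes P :: "real^'m^'m" and A :: "real^'n^'n" and E H :: "real^'n^'m"
  assumes "transpose P = P" "transpose A = A"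
  shows "trace (P ** (E ** A ** transpose H + H ** A ** transpose E)) = 2 * (E \<bullet> (P ** H ** A))"
proof -
  have 1: "trace (P ** (H ** A ** transpose E)) = E \<bullet> (P ** H ** A)"
    by (metis inner_matrix_eq_trace matrix_mul_assoc trace_mul_sym)
  have "trace (P ** (E ** A ** transpose H)) = trace (transpose (P ** (E ** A ** transpose H)))"
    by (simp add: trace_transpose)
  also have "\<dots> = trace ((H ** A ** transpose E) ** P)"
    using assms by (simp add: matrix_transpose_mul matrix_mul_assoc)
  also have "\<dots> = trace (P ** (H ** A ** transpose E))"
    by (rule trace_mul_sym)
  finally show ?thesis
    using 1 by (simp add: matrix_add_ldistrib trace_add)
qed

text \<open>Moving the symmetric \<open>A\<close> and the transposed \<open>E\<close> across the
  inner product puts \<open>E\<close> in the same position in both terms, with \<open>a\<close> and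
  \<open>g\<close> exchanged.\<close>

lemma inner_symmetrized_variation:
  fixes A :: "real^'n^'n" and E H :: "real^'n^'m"
  assumes "transpose A = A"
  shows "a \<bullet> ((E ** A ** transpose H + H ** A ** transpose E) *v g)
    = a \<bullet> (E *v (A *v (transpose H *v g))) + g \<bullet> (E *v (A *v (transpose H *v a)))"
proof -
  have "a \<bullet> (H *v (A *v (transpose E *v g))) = (A *v (transpose H *v a)) \<bullet> (transpose E *v g)"
    by (metis assms dot_lmul_matrix transpose_matrix_vector)
  also have "\<dots> = g \<bullet> (E *v (A *v (transpose H *v a)))"
    by (metis dot_lmul_matrix inner_commute transpose_matrix_vector)
  finally show ?thesis
    by (simp add: matrix_vector_mult_add_rdistrib inner_add_right
        del: transpose_matrix_vector flip: matrix_vector_mul_assoc)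
qed

section \<open>The mixture along a path of channel matrices\<close>

text \<open>A path with arbitrary velocity \<open>E\<close> reduces matrix differentiation to
  calculus in one real variable; the gradient is the matrix that \<open>E\<close> gets paired
  with.\<close>

locale mixture_path =
  fixes X :: "('k, 'n::finite) gauss_mix" and V :: "('l, 'm::finite) gauss_mix"
    and x :: "real^'n" and n :: "real^'m"
    and Hf :: "real \<Rightarrow> real^'n^'m" and E H :: "real^'n^'m" and t :: real
  assumes Hf: "(Hf has_vector_derivative E) (at t)" and Hf_at: "Hf t = H"
    and cov_X: "\<And>k. k \<in> gm_idx X \<Longrightarrow> sym_pos_def (gm_cov X k)"
    and cov_V: "\<And>l. l \<in> gm_idx V \<Longrightarrow> sym_pos_def (gm_cov V l)"
begin

text \<open>The observation moves with the path while \<open>x\<close> and \<open>n\<close> stay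
  fixed, so the derivatives below are total. \<open>g\<close> is the residual multiplied by the
  inverse covariance, and \<open>C'\<close> is the velocity of \<open>C_yy\<close>.\<close>

abbreviation (input) y where "y \<tau> \<equiv> Hf \<tau> *v x + n"
abbreviation (input) P where "P \<equiv> Cinv_yy X V H"
abbreviation (input) g where "g k l \<equiv> P k l *v w_vec X V H (H *v x + n) k l"
abbreviation (input) C' where
  "C' k \<equiv> E ** gm_cov X k ** transpose H + H ** gm_cov X k ** transpose E"

context
  fixes k l assumes k: "k \<in> gm_idx X" and l: "l \<in> gm_idx V"
begin

lemma sym_cov: "transpose (gm_cov X k) = gm_cov X k"
  using cov_X[OF k] by (simp add: sym_pos_def_def)

lemma sym_pos_def_C_yy: "sym_pos_def (C_yy X V H' k l)"
  unfolding C_yy_def by (rule sym_pos_def_congruence_add[OF cov_X[OF k] cov_V[OF l]])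

lemma det_C_yy_pos: "0 < det (C_yy X V H' k l)"
  by (rule sym_pos_def_det_pos[OF sym_pos_def_C_yy])

lemma sym_Cinv_yy: "transpose (P k l) = P k l"
  unfolding Cinv_yy_def using sym_pos_def_C_yy
  by (intro transpose_matrix_inv sym_pos_def_det_nonzero) (simp_all add: sym_pos_def_def)

lemma f_dens_pos: "0 < f_dens X V H' y' k l"
  unfolding f_dens_def by (simp add: det_C_yy_pos)

section \<open>Derivatives of the quantities of one component\<close>

lemma C_yy_deriv: "((\<lambda>\<tau>. C_yy X V (Hf \<tau>) k l) has_vector_derivative C' k) (at t)"
proof -
  have "((\<lambda>\<tau>. Hf \<tau> ** gm_cov X k ** transpose (Hf \<tau>) + gm_cov V l) has_vector_derivative
      (Hf t ** gm_cov X k) ** transpose E + (Hf t ** 0 + E ** gm_cov X k) ** transpose (Hf t) + 0) (at t)"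
    by (intro has_vector_derivative_add has_vector_derivative_matrix_mult
        has_vector_derivative_transpose Hf has_vector_derivative_const)
  then show ?thesis
    by (simp add: C_yy_def Hf_at add.commute bounded_bilinear.zero_right[OF bounded_bilinear_matrix_mult])
qed

lemma w_vec_deriv:
  "((\<lambda>\<tau>. w_vec X V (Hf \<tau>) (y \<tau>) k l) has_vector_derivative E *v (x - gm_mean X k)) (at t)"
proof -
  note lin = bounded_linear.has_vector_derivative[OF
      bounded_bilinear.bounded_linear_left[OF bounded_bilinear_matrix_vector_mult] Hf]
  have "((\<lambda>\<tau>. Hf \<tau> *v x + n - (Hf \<tau> *v gm_mean X k + gm_mean V l)) has_vector_derivative
      E *v x + 0 - (E *v gm_mean X k + 0)) (at t)"
    by (intro has_vector_derivative_add has_vector_derivative_diff lin has_vector_derivative_const)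
  then show ?thesis
    by (simp add: w_vec_def u_y_def matrix_vector_mult_diff_distrib)
qed

lemma whitened_deriv:
  "((\<lambda>\<tau>. Cinv_yy X V (Hf \<tau>) k l *v w_vec X V (Hf \<tau>) (y \<tau>) k l) has_vector_derivative
    P k l *v (E *v (x - gm_mean X k) - C' k *v g k l)) (at t)"
proof -
  have "((\<lambda>\<tau>. Cinv_yy X V (Hf \<tau>) k l) has_vector_derivative - (P k l ** C' k ** P k l)) (at t)"
    using has_vector_derivative_matrix_inv[OF C_yy_deriv]
      sym_pos_def_det_nonzero[OF sym_pos_def_C_yy]
    by (simp add: Cinv_yy_def Hf_at)
  from has_vector_derivative_matrix_vector_mult[OF this w_vec_deriv]
  show ?thesis
    by (simp add: Hf_at matrix_vector_mult_diff_distrib matrix_vector_mul_assoc matrix_mul_assoc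
        bounded_bilinear.minus_left[OF bounded_bilinear_matrix_vector_mult])
qed

text \<open>By symmetry of \<open>P\<close> and of the covariance, the subtracted part of
  \<open>R_mat\<close> has rank one. The three terms come from the moving residual, the
  log-determinant and the inverse covariance, in this order.\<close>

lemma inner_R_mat:
  "E \<bullet> R_mat X V H x (H *v x + n) k l = g k l \<bullet> (E *v (x - gm_mean X k))
    + E \<bullet> (P k l ** H ** gm_cov X k)
    - g k l \<bullet> (E *v (gm_cov X k *v (transpose H *v g k l)))"
proof -
  let ?w = "w_vec X V H (H *v x + n) k l"
  have "P k l ** (mat 1 - outer ?w ?w ** P k l) ** H ** gm_cov X k
      = P k l ** H ** gm_cov X k - outer (g k l) (gm_cov X k *v (transpose H *v g k l))"
    by (simp add: matrix_mult_diff_left matrix_mult_diff_right outer_matrix_mult matrix_mult_outer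
        sym_cov sym_Cinv_yy del: transpose_matrix_vector)
  then show ?thesis
    by (simp add: R_mat_def inner_add_right inner_diff_right inner_outer)
qed

lemma f_dens_deriv:
  "((\<lambda>\<tau>. f_dens X V (Hf \<tau>) (y \<tau>) k l) has_real_derivative
    - (f_dens X V H (H *v x + n) k l * (E \<bullet> R_mat X V H x (H *v x + n) k l))) (at t)"
proof -
  let ?w = "w_vec X V H (H *v x + n) k l" and ?d = "E *v (x - gm_mean X k)"
  define Q where "Q \<tau> = w_vec X V (Hf \<tau>) (y \<tau>) k l \<bullet>
    (Cinv_yy X V (Hf \<tau>) k l *v w_vec X V (Hf \<tau>) (y \<tau>) k l)" for \<tau>
  define \<Delta> where "\<Delta> \<tau> = det (C_yy X V (Hf \<tau>) k l)" for \<tau>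
  define c where "c = (2 * pi) powr (real CARD('m) / 2)"
  \<comment> \<open>The derivative of \<open>Q\<close> is
    \<open>2 * (g \<bullet> ?d) - g \<bullet> (C' *v g)\<close>; with \<open>g\<close> in both slots
    the two terms of the symmetrized variation coincide, whence the second factor 2.\<close>
  define Q' where "Q' = 2 * (g k l \<bullet> ?d) - 2 * (g k l \<bullet> (E *v (gm_cov X k *v (transpose H *v g k l))))"
  define T where "T = 2 * (E \<bullet> (P k l ** H ** gm_cov X k))"
  have "c > 0"
    by (simp add: c_def)
  have "(Q has_real_derivative ?w \<bullet> (P k l *v (?d - C' k *v g k l)) + ?d \<bullet> g k l) (at t)"
    using has_real_derivative_inner[OF w_vec_deriv whitened_deriv] unfolding Q_def Hf_at by simp
  moreover have "?w \<bullet> (P k l *v (?d - C' k *v g k l)) + ?d \<bullet> g k l = Q'"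
    unfolding Q'_def inner_commute[of ?d]
    by (simp only: inner_diff_right inner_symmetrized_variation[OF sym_cov]
        flip: inner_matrix_vector_mult_sym[OF sym_Cinv_yy, of ?w])
  ultimately have Q: "(Q has_real_derivative Q') (at t)"
    by simp
  \<comment> \<open>Jacobi's formula: \<open>T\<close> is the logarithmic derivative of the
    determinant.\<close>
  have "(\<Delta> has_real_derivative \<Delta> t * T) (at t)"
    using jacobi_formula[OF C_yy_deriv] det_C_yy_pos[of "Hf t"]
      trace_symmetrized_variation[OF sym_Cinv_yy sym_cov, of E H]
    unfolding \<Delta>_def T_def Cinv_yy_def Hf_at by simp
  moreover have "\<Delta> t > 0"
    by (simp add: \<Delta>_def det_C_yy_pos)
  \<comment> \<open>The density is multiplied by its logarithmic derivative: \<open>- Q' / 2\<close>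
    from the exponent and \<open>- T / 2\<close> from the square root in the denominator.\<close>
  ultimately have "((\<lambda>\<tau>. exp (- (1/2) * Q \<tau>) / (c * sqrt (\<Delta> \<tau>))) has_real_derivative
      exp (- (1/2) * Q t) / (c * sqrt (\<Delta> t)) * (- (1/2) * Q' - T / 2)) (at t)"
    using Q \<open>c > 0\<close>
    by (auto intro!: derivative_eq_intros simp: field_simps real_sqrt_mult_self power2_eq_square)
  moreover have "- (1/2) * Q' - T / 2 = - (E \<bullet> R_mat X V H x (H *v x + n) k l)"
  proof -
    have "- (1/2) * (2 * a - 2 * b) - 2 * c / 2 = - (a + c - b)" for a b c :: real
      by (simp add: field_simps)
    then show ?thesis
      unfolding Q'_def T_def inner_R_mat .
  qed
  ultimately show ?thesis
    unfolding f_dens_def Q_def \<Delta>_def c_def Hf_at by simp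
qed

text \<open>The squared norm involves the velocity \<open>u'\<close> only through inner products
  with component means. Moving all factors except \<open>E\<close> to the other side of such a
  product leaves exactly the pairing with \<open>D_mat\<close>.\<close>

lemma u_comp_deriv:
  obtains u' where "((\<lambda>\<tau>. u_comp X V (Hf \<tau>) (y \<tau>) k l) has_vector_derivative u') (at t)"
    and "\<And>r s. u' \<bullet> u_comp X V H (H *v x + n) r s = E \<bullet> D_mat X V H x (H *v x + n) k l r s"
proof
  let ?d = "E *v (x - gm_mean X k)" and ?A = "gm_cov X k"
  define u' where "u' = ?A *v (transpose H *v (P k l *v (?d - C' k *v g k l)))
    + ?A *v (transpose E *v g k l)"
  have "((\<lambda>\<tau>. gm_mean X k + (?A ** transpose (Hf \<tau>)) *v
      (Cinv_yy X V (Hf \<tau>) k l *v w_vec X V (Hf \<tau>) (y \<tau>) k l)) has_vector_derivative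
      0 + ((?A ** transpose (Hf t)) *v (P k l *v (?d - C' k *v g k l))
      + (?A ** transpose E + 0 ** transpose (Hf t)) *v (Cinv_yy X V (Hf t) k l *v w_vec X V (Hf t) (y t) k l))) (at t)"
    by (intro has_vector_derivative_add has_vector_derivative_matrix_vector_mult whitened_deriv
        has_vector_derivative_matrix_mult has_vector_derivative_transpose Hf has_vector_derivative_const)
  then show "((\<lambda>\<tau>. u_comp X V (Hf \<tau>) (y \<tau>) k l) has_vector_derivative u') (at t)"
    by (simp add: u_comp_def u'_def Hf_at matrix_vector_mul_assoc matrix_mul_assoc
        bounded_bilinear.zero_left[OF bounded_bilinear_matrix_mult] del: transpose_matrix_vector)
  fix r s
  let ?v = "u_comp X V H (H *v x + n) r s"
  let ?a = "(P k l ** H ** ?A) *v ?v"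
  have a: "(?A *v (transpose H *v (P k l *v b))) \<bullet> ?v = ?a \<bullet> b" for b
    unfolding inner_matrix_vector_mult_sym[OF sym_cov] transpose_matrix_vector dot_lmul_matrix
      inner_matrix_vector_mult_sym[OF sym_Cinv_yy]
    by (simp add: inner_commute matrix_vector_mul_assoc matrix_mul_assoc)
  have e: "(?A *v (transpose E *v g k l)) \<bullet> ?v = g k l \<bullet> (E *v (?A *v ?v))"
    unfolding inner_matrix_vector_mult_sym[OF sym_cov] transpose_matrix_vector dot_lmul_matrix ..
  \<comment> \<open>\<open>C_mat\<close> has rank one, so \<open>C_mat\<close> plus its transpose
    matches the two terms of the symmetrized variation in
    \<open>?a \<bullet> (C' k *v g k l)\<close>.\<close>
  have C: "C_mat X V H (H *v x + n) k l r s = outer (g k l) ?a"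
    by (simp add: C_mat_def outer_matrix_mult matrix_transpose_mul sym_cov sym_Cinv_yy matrix_mul_assoc
        matrix_vector_mul_assoc del: transpose_matrix_vector)
  have "u' \<bullet> ?v = ?a \<bullet> ?d - ?a \<bullet> (C' k *v g k l) + g k l \<bullet> (E *v (?A *v ?v))"
    unfolding u'_def inner_add_left a e inner_diff_right ..
  also have "\<dots> = E \<bullet> D_mat X V H x (H *v x + n) k l r s"
    unfolding D_mat_def C transpose_outer
    by (simp add: inner_symmetrized_variation[OF sym_cov] inner_add_right inner_diff_right inner_outer
        outer_matrix_mult matrix_mult_add_left sym_cov del: transpose_matrix_vector)
  finally show "u' \<bullet> ?v = E \<bullet> D_mat X V H x (H *v x + n) k l r s" .
qed

end

section \<open>Derivatives of the mixture sums\<close>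

lemma f_mix_deriv:
  "((\<lambda>\<tau>. f_mix X V (Hf \<tau>) (y \<tau>)) has_real_derivative
    - (E \<bullet> (\<Sum>k\<in>gm_idx X. \<Sum>l\<in>gm_idx V. (gm_weight X k * gm_weight V l *
        f_dens X V H (H *v x + n) k l) *\<^sub>R R_mat X V H x (H *v x + n) k l))) (at t)"
  unfolding f_mix_def inner_sum_right sum_negf[symmetric]
  by (intro DERIV_sum DERIV_cong[OF DERIV_cmult[OF f_dens_deriv]]) (auto simp: algebra_simps)

text \<open>Product rule: the two densities in \<open>h_coef\<close> yield the \<open>R_mat\<close>
  terms with a minus sign, the two means in \<open>z_coef\<close> yield the \<open>D_mat\<close>
  terms.\<close>

lemma h_coef_z_coef_deriv:
  assumes idx: "k \<in> gm_idx X" "l \<in> gm_idx V" "r \<in> gm_idx X" "s \<in> gm_idx V"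
  shows "((\<lambda>\<tau>. h_coef X V (Hf \<tau>) (y \<tau>) k l r s * z_coef X V (Hf \<tau>) (y \<tau>) k l r s)
    has_real_derivative
    E \<bullet> (h_coef X V H (H *v x + n) k l r s *\<^sub>R
        (D_mat X V H x (H *v x + n) k l r s + D_mat X V H x (H *v x + n) r s k l)
      - (h_coef X V H (H *v x + n) k l r s * z_coef X V H (H *v x + n) k l r s) *\<^sub>R
        (R_mat X V H x (H *v x + n) k l + R_mat X V H x (H *v x + n) r s))) (at t)"
proof -
  obtain u1 where u1: "((\<lambda>\<tau>. u_comp X V (Hf \<tau>) (y \<tau>) k l) has_vector_derivative u1) (at t)"
    and D1: "\<And>r s. u1 \<bullet> u_comp X V H (H *v x + n) r s = E \<bullet> D_mat X V H x (H *v x + n) k l r s"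
    using u_comp_deriv[OF idx(1,2)] by blast
  obtain u2 where u2: "((\<lambda>\<tau>. u_comp X V (Hf \<tau>) (y \<tau>) r s) has_vector_derivative u2) (at t)"
    and D2: "\<And>k l. u2 \<bullet> u_comp X V H (H *v x + n) k l = E \<bullet> D_mat X V H x (H *v x + n) r s k l"
    using u_comp_deriv[OF idx(3,4)] by blast
  have z: "((\<lambda>\<tau>. z_coef X V (Hf \<tau>) (y \<tau>) k l r s) has_real_derivative
      E \<bullet> D_mat X V H x (H *v x + n) k l r s + E \<bullet> D_mat X V H x (H *v x + n) r s k l) (at t)"
    unfolding z_coef_def
    by (rule DERIV_cong[OF has_real_derivative_inner[OF u1 u2]])
      (simp add: D1 Hf_at inner_commute[of _ u2] D2)
  have h: "((\<lambda>\<tau>. h_coef X V (Hf \<tau>) (y \<tau>) k l r s) has_real_derivative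
      - (h_coef X V H (H *v x + n) k l r s * (E \<bullet> R_mat X V H x (H *v x + n) k l
        + E \<bullet> R_mat X V H x (H *v x + n) r s))) (at t)"
    unfolding h_coef_def
    by (rule DERIV_cong[OF DERIV_mult[OF DERIV_cmult[OF f_dens_deriv[OF idx(1,2)]]
          f_dens_deriv[OF idx(3,4)]]])
      (simp add: Hf_at algebra_simps)
  show ?thesis
    by (rule DERIV_cong[OF DERIV_mult[OF h z]])
      (simp add: Hf_at inner_add_right inner_diff_right algebra_simps)
qed

end

section \<open>The gradient\<close>

lemma f_mix_power2_eq_sum_h_coef:
  "(f_mix X V H y)\<^sup>2 = (\<Sum>k\<in>gm_idx X. \<Sum>l\<in>gm_idx V. \<Sum>r\<in>gm_idx X. \<Sum>s\<in>gm_idx V. h_coef X V H y k l r s)"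
  unfolding f_mix_def h_coef_def power2_eq_square sum_distrib_right unfolding sum_distrib_left
  by (simp add: mult_ac)

text \<open>Bilinearity expands the squared norm of the weighted sum of means over pairs of
  components; the common denominator comes out squared.\<close>

lemma G_breve_eq_quotient:
  "G_breve X V H y = (\<Sum>k\<in>gm_idx X. \<Sum>l\<in>gm_idx V. \<Sum>r\<in>gm_idx X. \<Sum>s\<in>gm_idx V.
     h_coef X V H y k l r s * z_coef X V H y k l r s) / (f_mix X V H y)\<^sup>2"
proof -
  define S where "S = (\<Sum>k\<in>gm_idx X. \<Sum>l\<in>gm_idx V.
    (gm_weight X k * gm_weight V l * f_dens X V H y k l) *\<^sub>R u_comp X V H y k l)"
  have "G_breve X V H y = (S \<bullet> S) / (f_mix X V H y)\<^sup>2"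
    by (simp add: G_breve_def u_mmse_def S_def[symmetric] dot_square_norm power_mult_distrib
        power_inverse divide_inverse)
  also have "S \<bullet> S = (\<Sum>k\<in>gm_idx X. \<Sum>l\<in>gm_idx V. \<Sum>r\<in>gm_idx X. \<Sum>s\<in>gm_idx V.
     h_coef X V H y k l r s * z_coef X V H y k l r s)"
    unfolding S_def inner_sum_left inner_sum_right h_coef_def z_coef_def
    by (intro sum.cong refl) (simp add: mult_ac inner_commute)
  finally show ?thesis .
qed

text \<open>Each family of weights sums to one, so it has a positive member; that pair of components
  gives a positive term among nonnegative ones.\<close>

lemma f_mix_pos:
  assumes "finite (gm_idx X)" "finite (gm_idx V)"
    and p: "\<And>k. k \<in> gm_idx X \<Longrightarrow> 0 \<le> gm_weight X k" and q: "\<And>l. l \<in> gm_idx V \<Longrightarrow> 0 \<le> gm_weight V l"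
    and "(\<Sum>k\<in>gm_idx X. gm_weight X k) = 1" "(\<Sum>l\<in>gm_idx V. gm_weight V l) = 1"
    and f: "\<And>k l. k \<in> gm_idx X \<Longrightarrow> l \<in> gm_idx V \<Longrightarrow> 0 < f_dens X V H y k l"
  shows "0 < f_mix X V H y"
proof -
  have "\<exists>k\<in>gm_idx X. gm_weight X k \<noteq> 0" "\<exists>l\<in>gm_idx V. gm_weight V l \<noteq> 0"
    using assms(5,6) by (metis sum.neutral zero_neq_one)+
  then obtain k l where kl: "k \<in> gm_idx X" "l \<in> gm_idx V" "0 < gm_weight X k" "0 < gm_weight V l"
    using p q by (metis order_le_less)
  have nonneg: "0 \<le> gm_weight X k * gm_weight V l * f_dens X V H y k l"
    if "k \<in> gm_idx X" "l \<in> gm_idx V" for k l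
    using that p q f by (simp add: less_imp_le)
  show ?thesis
    unfolding f_mix_def
    using assms(1,2) kl f nonneg
    by (intro sum_pos2[of _ k] sum_pos2[of _ l] sum_nonneg) auto
qed

theorem mainTheorem2:
  fixes X :: "('k, 'n::finite) gauss_mix" and V :: "('l, 'm::finite) gauss_mix"
    and x :: "real^'n" and n :: "real^'m" and H :: "real^'n^'m"
  defines "K \<equiv> gm_idx X" and "L \<equiv> gm_idx V" and "p \<equiv> gm_weight X" and "q \<equiv> gm_weight V"
  defines "y \<equiv> H *v x + n"
  defines "f \<equiv> f_dens X V H y" and "h \<equiv> h_coef X V H y" and "z \<equiv> z_coef X V H y"
    and "R \<equiv> R_mat X V H x y" and "D \<equiv> D_mat X V H x y"
  assumes "finite K" and "finite L"
    and "\<And>k. k \<in> K \<Longrightarrow> 0 \<le> p k" and "\<And>l. l \<in> L \<Longrightarrow> 0 \<le> q l"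
    and "(\<Sum>k\<in>K. p k) = 1" and "(\<Sum>l\<in>L. q l) = 1"
    and "\<And>k. k \<in> K \<Longrightarrow> sym_pos_def (gm_cov X k)"
    and "\<And>l. l \<in> L \<Longrightarrow> sym_pos_def (gm_cov V l)"
  shows "has_matrix_gradient (\<lambda>H'. G_breve X V H' (H' *v x + n))
    (- ((\<Sum>k\<in>K. \<Sum>l\<in>L. \<Sum>r\<in>K. \<Sum>s\<in>L. (h k l r s * z k l r s) *\<^sub>R (R k l + R r s))
          /\<^sub>R (\<Sum>k\<in>K. \<Sum>l\<in>L. \<Sum>r\<in>K. \<Sum>s\<in>L. h k l r s))
     + (\<Sum>k\<in>K. \<Sum>l\<in>L. \<Sum>r\<in>K. \<Sum>s\<in>L. h k l r s *\<^sub>R (D k l r s + D r s k l))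
          /\<^sub>R (\<Sum>k\<in>K. \<Sum>l\<in>L. \<Sum>r\<in>K. \<Sum>s\<in>L. h k l r s)
     + ((2 * (\<Sum>k\<in>K. \<Sum>l\<in>L. \<Sum>r\<in>K. \<Sum>s\<in>L. h k l r s * z k l r s))
          *\<^sub>R (\<Sum>k\<in>K. \<Sum>l\<in>L. (p k * q l * f k l) *\<^sub>R R k l))
          /\<^sub>R ((\<Sum>i\<in>K. \<Sum>j\<in>L. p i * q j * f i j)
               * (\<Sum>k\<in>K. \<Sum>l\<in>L. \<Sum>r\<in>K. \<Sum>s\<in>L. h k l r s)))
    H"
proof -
  define A where "A = (\<Sum>k\<in>K. \<Sum>l\<in>L. \<Sum>r\<in>K. \<Sum>s\<in>L. (h k l r s * z k l r s) *\<^sub>R (R k l + R r s))"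
  define B where "B = (\<Sum>k\<in>K. \<Sum>l\<in>L. \<Sum>r\<in>K. \<Sum>s\<in>L. h k l r s *\<^sub>R (D k l r s + D r s k l))"
  define N where "N = (\<Sum>k\<in>K. \<Sum>l\<in>L. \<Sum>r\<in>K. \<Sum>s\<in>L. h k l r s * z k l r s)"
  define W where "W = (\<Sum>k\<in>K. \<Sum>l\<in>L. (p k * q l * f k l) *\<^sub>R R k l)"
  define F where "F = f_mix X V H y"
  have F: "F = (\<Sum>i\<in>K. \<Sum>j\<in>L. p i * q j * f i j)"
    by (simp add: F_def f_mix_def K_def L_def p_def q_def f_def)
  have F2: "F\<^sup>2 = (\<Sum>k\<in>K. \<Sum>l\<in>L. \<Sum>r\<in>K. \<Sum>s\<in>L. h k l r s)"
    by (simp add: F_def f_mix_power2_eq_sum_h_coef K_def L_def h_def)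
  have "((\<lambda>t. G_breve X V (\<chi> a b. if a = i \<and> b = j then t else H $ a $ b)
      ((\<chi> a b. if a = i \<and> b = j then t else H $ a $ b) *v x + n)) has_real_derivative
      (- (A /\<^sub>R F\<^sup>2) + B /\<^sub>R F\<^sup>2 + ((2 * N) *\<^sub>R W) /\<^sub>R (F * F\<^sup>2)) $ i $ j) (at (H $ i $ j))" for i j
  proof -
    define Hf where "Hf t = (\<chi> a b. if a = i \<and> b = j then t else H $ a $ b)" for t
    \<comment> \<open>The velocity of the path that varies only entry \<open>(i, j)\<close> is a
      matrix unit, and pairing with it extracts that entry.\<close>
    define E :: "real^'n^'m" where "E = (\<chi> a b. if a = i \<and> b = j then 1 else 0)"
    have E: "E \<bullet> M = M $ i $ j" for M
    proof -
      have "E \<bullet> M = (\<Sum>a\<in>UNIV. \<Sum>b\<in>UNIV. if b = j then (if a = i then M $ a $ b else 0) else 0)"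
        unfolding inner_vec_def E_def by (intro sum.cong) auto
      then show ?thesis
        by simp
    qed
    interpret mixture_path X V x n Hf E H "H $ i $ j"
    proof
      show "(Hf has_vector_derivative E) (at (H $ i $ j))"
        unfolding has_vector_derivative_matrix_iff by (auto simp: Hf_def E_def)
      show "Hf (H $ i $ j) = H"
        by (auto simp: Hf_def vec_eq_iff)
    qed (use assms in auto)
    have "F > 0"
      unfolding F_def using assms f_dens_pos by (intro f_mix_pos) auto
    have N': "((\<lambda>t. \<Sum>k\<in>K. \<Sum>l\<in>L. \<Sum>r\<in>K. \<Sum>s\<in>L. h_coef X V (Hf t) (Hf t *v x + n) k l r s *
        z_coef X V (Hf t) (Hf t *v x + n) k l r s) has_real_derivative E \<bullet> (B - A)) (at (H $ i $ j))"
      unfolding A_def B_def h_def z_def R_def D_def y_def sum_subtractf[symmetric] inner_sum_right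
      by (intro DERIV_sum h_coef_z_coef_deriv) (auto simp: K_def L_def)
    have F': "((\<lambda>t. f_mix X V (Hf t) (Hf t *v x + n)) has_real_derivative - (E \<bullet> W)) (at (H $ i $ j))"
      using f_mix_deriv by (simp add: W_def K_def L_def p_def q_def f_def R_def y_def)
    have at_H: "f_mix X V (Hf (H $ i $ j)) (Hf (H $ i $ j) *v x + n) = F"
      "(\<Sum>k\<in>K. \<Sum>l\<in>L. \<Sum>r\<in>K. \<Sum>s\<in>L.
          h_coef X V (Hf (H $ i $ j)) (Hf (H $ i $ j) *v x + n) k l r s *
          z_coef X V (Hf (H $ i $ j)) (Hf (H $ i $ j) *v x + n) k l r s) = N"
      by (simp_all add: Hf_at F_def N_def h_def z_def y_def)
    \<comment> \<open>Quotient rule with numerator \<open>N\<close> and denominator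
      \<open>F\<^sup>2\<close>; positivity of \<open>F\<close> permits the division.\<close>
    have "((\<lambda>t. G_breve X V (Hf t) (Hf t *v x + n)) has_real_derivative
        (E \<bullet> (B - A) * F\<^sup>2 - N * (2 * (- (E \<bullet> W) * F))) / (F\<^sup>2 * F\<^sup>2)) (at (H $ i $ j))"
      unfolding G_breve_eq_quotient K_def[symmetric] L_def[symmetric]
      by (rule DERIV_cong[OF DERIV_divide[OF N' DERIV_power[OF F', of 2]]])
        (use \<open>F > 0\<close> in \<open>simp_all only: at_H\<close>, simp_all)
    \<comment> \<open>Cancelling powers of \<open>F\<close> leaves \<open>F * F\<^sup>2\<close>
      under the \<open>W\<close> term; by \<open>F\<close> and \<open>F2\<close> this is the product
      of sums in the third denominator of the claim.\<close>
    moreover have "(E \<bullet> (B - A) * F\<^sup>2 - N * (2 * (- (E \<bullet> W) * F))) / (F\<^sup>2 * F\<^sup>2)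
        = (- (A /\<^sub>R F\<^sup>2) + B /\<^sub>R F\<^sup>2 + ((2 * N) *\<^sub>R W) /\<^sub>R (F * F\<^sup>2)) $ i $ j"
      using \<open>F > 0\<close> by (simp add: E field_simps power2_eq_square)
    ultimately show ?thesis
      by (simp add: Hf_def)
  qed
  then show ?thesis
    unfolding has_matrix_gradient_def A_def B_def N_def W_def F2[symmetric] F[symmetric] by blast
qed

end
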